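(* Let $d\in\mathbb{N}$. Let $\mathcal{M}_d$ be the set of all finite positive Borel measures on $\mathbb{R}^d$, let $\mathcal{SM}_d$ be the set of all $\mu\in\mathcal{M}_d$ that are spectral, and let $\mathcal{A}_d$ be the affine group of $\mathbb{R}^d$. Via the formula $R(a)\mu:=\mu\circ a^{-1}$ ($a\in\mathcal{A}_d$, $\mu\in\mathcal{M}_d$), the group $\mathcal{A}_d$ acts as a transformation group on $\mathcal{M}_d$, and $\mathcal{SM}_d$ is invariant, i.e., if $a\in\mathcal{A}_d$ and $\mu\in\mathcal{SM}_d$ then $R(a)\mu\in\mathcal{SM}_d$. Moreover, if $a\in\mathcal{A}_d$ with $a(x)=Vx+s$, then for $\Lambda\subset\mathbb{R}^d$, $$\Lambda\in\mathcal{S}(R(a)\mu)\quad\text{if and only if}\quad V^T\Lambda\in\mathcal{S}(\mu).$$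
   Context: The affine group $\mathcal{A}_d$ consists of all invertible affine transformations $x\mapsto Vx+s$ of $\mathbb{R}^d$, with $V\in GL_d(\mathbb{R})$ and $s\in\mathbb{R}^d$. For $\lambda\in\mathbb{R}^d$ let $e_\lambda(x)=e^{2\pi i\lambda\cdot x}$. A measure $\mu\in\mathcal{M}_d$ is spectral if there exists $\Lambda\subset\mathbb{R}^d$ such that the family $(e_\lambda)_{\lambda\in\Lambda}$ is an orthogonal basis of $L^2(\mu)$; such $\Lambda$ is called a spectrum for $\mu$, and $\mathcal{S}(\mu)$ denotes the collection of all spectra $\Lambda$ of $\mu$. The measure $\mu\circ a^{-1}$ is the push-forward $E\mapsto\mu(a^{-1}(E))$. *)

theory Defs
  imports "HOL-Analysis.Analysis" "HOL-Algebra.Group_Action"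
begin

definition affine_group :: "(real^'n \<Rightarrow> real^'n) monoid" where
  "affine_group =
    \<lparr>carrier = {a. \<exists>V s. invertible (V :: real^'n^'n) \<and> a = (\<lambda>x. V *v x + s)},
     mult = (\<circ>),
     one = id\<rparr>"

definition finite_borel_measures :: "(real^'n) measure set" where
  "finite_borel_measures = {\<mu>. sets \<mu> = sets borel \<and> finite_measure \<mu>}"

definition push_forward ::
  "(real^'n \<Rightarrow> real^'n) \<Rightarrow> (real^'n) measure \<Rightarrow> (real^'n) measure" where
  "push_forward a \<mu> = distr \<mu> borel a"

text \<open>
  Elements of \<open>L\<^sup>2(\<mu>)\<close> are represented by functions rather than by classes modulo
  equality almost everywhere; accordingly a representative is nonzero in \<open>L\<^sup>2(\<mu>)\<close>
  iff its seminorm is nonzero.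
\<close>

definition L2_space :: "'a measure \<Rightarrow> ('a \<Rightarrow> complex) set" where
  "L2_space \<mu> = {f \<in> borel_measurable \<mu>. integrable \<mu> (\<lambda>x. (cmod (f x))\<^sup>2)}"

definition L2_inner :: "'a measure \<Rightarrow> ('a \<Rightarrow> complex) \<Rightarrow> ('a \<Rightarrow> complex) \<Rightarrow> complex" where
  "L2_inner \<mu> f g = (\<integral>x. f x * cnj (g x) \<partial>\<mu>)"

definition L2_norm :: "'a measure \<Rightarrow> ('a \<Rightarrow> complex) \<Rightarrow> real" where
  "L2_norm \<mu> f = sqrt (\<integral>x. (cmod (f x))\<^sup>2 \<partial>\<mu>)"

text \<open>
  An orthogonal basis of the Hilbert space \<open>L\<^sup>2(\<mu>)\<close>: a family of nonzero, pairwise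
  orthogonal elements whose finite linear combinations are norm dense.
\<close>

definition L2_orthogonal_basis ::
  "'a measure \<Rightarrow> 'i set \<Rightarrow> ('i \<Rightarrow> 'a \<Rightarrow> complex) \<Rightarrow> bool" where
  "L2_orthogonal_basis \<mu> I u \<longleftrightarrow>
     (\<forall>i\<in>I. u i \<in> L2_space \<mu> \<and> L2_norm \<mu> (u i) \<noteq> 0) \<and>
     (\<forall>i\<in>I. \<forall>j\<in>I. i \<noteq> j \<longrightarrow> L2_inner \<mu> (u i) (u j) = 0) \<and>
     (\<forall>f\<in>L2_space \<mu>. \<forall>\<epsilon>>0. \<exists>F c. finite F \<and> F \<subseteq> I \<and>
        L2_norm \<mu> (\<lambda>x. f x - (\<Sum>i\<in>F. c i * u i x)) < \<epsilon>)"

definition exponential :: "real^'n \<Rightarrow> real^'n \<Rightarrow> complex" where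
  "exponential l x = exp (2 * of_real pi * \<i> * of_real (l \<bullet> x))"

definition spectra :: "(real^'n) measure \<Rightarrow> (real^'n) set set" where
  "spectra \<mu> = {\<Lambda>. L2_orthogonal_basis \<mu> \<Lambda> exponential}"

definition spectral_measures :: "(real^'n) measure set" where
  "spectral_measures = {\<mu> \<in> finite_borel_measures. \<exists>\<Lambda>. \<Lambda> \<in> spectra \<mu>}"

end

theory Submission
  imports Defs
begin

text \<open>
  Composition with an affine bijection \<open>a\<close> is an isometry from \<open>L\<^sup>2(\<mu> \<circ> a\<^sup>-\<^sup>1)\<close> onto \<open>L\<^sup>2(\<mu>)\<close>, and it
  sends \<open>e\<^sub>l\<close> to the function with frequency \<open>V\<^sup>T l\<close> multiplied by the unimodular constant
  \<open>e\<^sub>l(s)\<close>. Orthogonal bases are preserved by such isometries, by rescaling their members, and by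
  the injective reindexing \<open>l \<mapsto> V\<^sup>T l\<close>.
\<close>

section \<open>Image measures and the L2 seminorm\<close>

lemma distr_distr_inverse:
  assumes "a \<in> measurable M N" "b \<in> measurable N M" "\<And>x. x \<in> space M \<Longrightarrow> b (a x) = x"
  shows "distr (distr M N a) M b = M"
proof -
  have "distr (distr M N a) M b = distr M M (b \<circ> a)"
    using assms(1,2) by (simp add: distr_distr)
  also have "\<dots> = distr M M (\<lambda>x. x)"
    using assms(3) by (intro distr_cong) auto
  finally show ?thesis by simp
qed

lemma L2_norm_distr:
  assumes "a \<in> measurable M N" "f \<in> borel_measurable N"
  shows "L2_norm (distr M N a) f = L2_norm M (\<lambda>x. f (a x))"
  using assms by (simp add: L2_norm_def integral_distr)

lemma L2_inner_distr:
  assumes "a \<in> measurable M N" "f \<in> borel_measurable N" "g \<in> borel_measurable N"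
  shows "L2_inner (distr M N a) f g = L2_inner M (\<lambda>x. f (a x)) (\<lambda>x. g (a x))"
proof -
  have "(\<lambda>x. f x * cnj (g x)) \<in> borel_measurable N"
    using assms(2,3)
    by (intro borel_measurable_times measurable_compose[of g N borel cnj]
        borel_measurable_continuous_onI continuous_intros) auto
  then show ?thesis
    using assms(1) by (simp add: L2_inner_def integral_distr)
qed

lemma L2_space_distr:
  assumes "a \<in> measurable M N" "f \<in> borel_measurable N"
  shows "f \<in> L2_space (distr M N a) \<longleftrightarrow> (\<lambda>x. f (a x)) \<in> L2_space M"
proof -
  have "(\<lambda>x. (cmod (f x))\<^sup>2) \<in> borel_measurable N" "(\<lambda>x. f (a x)) \<in> borel_measurable M"
    using assms by measurable
  then show ?thesis
    using assms by (simp add: L2_space_def integrable_distr_eq)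
qed

lemma L2_norm_cong: "(\<And>x. x \<in> space M \<Longrightarrow> f x = g x) \<Longrightarrow> L2_norm M f = L2_norm M g"
  unfolding L2_norm_def by (auto intro!: arg_cong[where f = sqrt] Bochner_Integration.integral_cong)

section \<open>Orthogonal bases and exponentials under change of variables\<close>

lemma L2_orthogonal_basis_dense:
  assumes "L2_orthogonal_basis M I u" "f \<in> L2_space M" "\<epsilon> > 0"
  obtains F c where "finite F" "F \<subseteq> I" "L2_norm M (\<lambda>x. f x - (\<Sum>i\<in>F. c i * u i x)) < \<epsilon>"
  using assms unfolding L2_orthogonal_basis_def by blast

text \<open>Norms and inner products of the \<open>u i\<close> are carried over by change of
  variables. For density, the function to approximate in the image space is \<open>f\<close>
  composed with \<open>b\<close>: pulled back along \<open>a\<close> it becomes \<open>f\<close>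
  again on \<open>space M\<close>, so the approximation error is the same on both sides.\<close>

lemma L2_orthogonal_basis_of_distr:
  assumes a: "a \<in> measurable M N" and b: "b \<in> measurable N M"
    and ba: "\<And>x. x \<in> space M \<Longrightarrow> b (a x) = x"
    and basis: "L2_orthogonal_basis (distr M N a) I u"
  shows "L2_orthogonal_basis M I (\<lambda>i x. u i (a x))"
proof -
  have u: "u i \<in> borel_measurable N" "u i \<in> L2_space (distr M N a)"
    "L2_norm (distr M N a) (u i) \<noteq> 0" if "i \<in> I" for i
    using basis that by (auto simp: L2_orthogonal_basis_def L2_space_def)
  have orth: "L2_inner (distr M N a) (u i) (u j) = 0" if "i \<in> I" "j \<in> I" "i \<noteq> j" for i j
    using basis that by (auto simp: L2_orthogonal_basis_def)
  have dense: "\<exists>F c. finite F \<and> F \<subseteq> I \<and> L2_norm M (\<lambda>x. f x - (\<Sum>i\<in>F. c i * u i (a x))) < \<epsilon>"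
    if f: "f \<in> L2_space M" and "\<epsilon> > 0" for f and \<epsilon> :: real
  proof -
    have fb: "(\<lambda>y. f (b y)) \<in> borel_measurable N"
      using b f by (auto simp: L2_space_def)
    \<comment> \<open>Measurability and integrability on \<open>M\<close> depend only on the values
      on \<open>space M\<close>, where \<open>b (a x) = x\<close>.\<close>
    have "(\<lambda>x. f (b (a x))) \<in> L2_space M \<longleftrightarrow> f \<in> L2_space M"
      unfolding L2_space_def
      by (auto simp: ba cong: measurable_cong Bochner_Integration.integrable_cong)
    then have "(\<lambda>y. f (b y)) \<in> L2_space (distr M N a)"
      using f L2_space_distr[OF a fb] by simp
    from L2_orthogonal_basis_dense[OF basis this \<open>\<epsilon> > 0\<close>] obtain F c where F: "finite F" "F \<subseteq> I"
      and less: "L2_norm (distr M N a) (\<lambda>y. f (b y) - (\<Sum>i\<in>F. c i * u i y)) < \<epsilon>" .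
    have "(\<lambda>y. f (b y) - (\<Sum>i\<in>F. c i * u i y)) \<in> borel_measurable N"
      using fb F u(1) by (intro borel_measurable_diff borel_measurable_sum borel_measurable_times) auto
    then have "L2_norm (distr M N a) (\<lambda>y. f (b y) - (\<Sum>i\<in>F. c i * u i y))
        = L2_norm M (\<lambda>x. f (b (a x)) - (\<Sum>i\<in>F. c i * u i (a x)))"
      by (rule L2_norm_distr[OF a])
    also have "\<dots> = L2_norm M (\<lambda>x. f x - (\<Sum>i\<in>F. c i * u i (a x)))"
      by (rule L2_norm_cong) (simp add: ba)
    finally show ?thesis
      using F less by auto
  qed
  show ?thesis
    unfolding L2_orthogonal_basis_def
    using u orth dense
    by (auto simp: L2_space_distr[OF a u(1)] L2_norm_distr[OF a u(1)] L2_inner_distr[OF a u(1) u(1)])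
qed

text \<open>The converse is the preceding transport with \<open>a\<close> and \<open>b\<close>
  exchanged: pushing the image measure forward along \<open>b\<close> recovers \<open>M\<close>. The
  identity \<open>a (b y) = y\<close> is assumed for every \<open>y\<close>, so that the doubly
  transported family is literally \<open>u\<close> and not merely equal to it on the underlying
  space.\<close>

lemma L2_orthogonal_basis_distr_iff:
  assumes a: "a \<in> measurable M N" and b: "b \<in> measurable N M"
    and ba: "\<And>x. x \<in> space M \<Longrightarrow> b (a x) = x" and ab: "\<And>y. a (b y) = y"
  shows "L2_orthogonal_basis (distr M N a) I u \<longleftrightarrow> L2_orthogonal_basis M I (\<lambda>i x. u i (a x))"
proof
  assume "L2_orthogonal_basis M I (\<lambda>i x. u i (a x))"
  then have "L2_orthogonal_basis (distr (distr M N a) M b) I (\<lambda>i x. u i (a x))"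
    by (simp add: distr_distr_inverse[OF a b ba])
  then have "L2_orthogonal_basis (distr M N a) I (\<lambda>i y. u i (a (b y)))"
    using a b by (intro L2_orthogonal_basis_of_distr[where N = M and a = b and b = a]) (simp_all add: ab)
  then show "L2_orthogonal_basis (distr M N a) I u"
    by (simp add: ab)
qed (rule L2_orthogonal_basis_of_distr[OF a b ba])

text \<open>Norms are multiplied by the nonzero number \<open>cmod (k i)\<close>, vanishing inner
  products stay zero, and a combination with coefficients \<open>c i\<close> becomes one with
  coefficients \<open>c i / k i\<close>. Relating \<open>v\<close> to \<open>u\<close> by an
  equation on \<open>I\<close> lets the same lemma remove a factor as well as insert one.\<close>

lemma L2_orthogonal_basis_scale:
  assumes basis: "L2_orthogonal_basis M I u" and k: "\<And>i. i \<in> I \<Longrightarrow> k i \<noteq> 0"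
    and v: "\<And>i x. i \<in> I \<Longrightarrow> v i x = k i * u i x"
  shows "L2_orthogonal_basis M I v"
proof -
  have v_eq: "v i = (\<lambda>x. k i * u i x)" if "i \<in> I" for i
    using v that by auto
  have norm: "L2_norm M (\<lambda>x. z * f x) = cmod z * L2_norm M f" for z f
    by (simp add: L2_norm_def norm_mult power_mult_distrib real_sqrt_mult)
  have space: "(\<lambda>x. z * f x) \<in> L2_space M" if "f \<in> L2_space M" for z f
    using that by (auto simp: L2_space_def norm_mult power_mult_distrib)
  have inner: "L2_inner M (\<lambda>x. z * f x) (\<lambda>x. w * g x) = z * cnj w * L2_inner M f g" for z w f g
  proof -
    have "L2_inner M (\<lambda>x. z * f x) (\<lambda>x. w * g x) = (\<integral>x. (z * cnj w) * (f x * cnj (g x)) \<partial>M)"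
      unfolding L2_inner_def by (simp add: ac_simps)
    then show ?thesis by (simp add: L2_inner_def)
  qed
  have dense: "\<exists>F c. finite F \<and> F \<subseteq> I \<and> L2_norm M (\<lambda>x. f x - (\<Sum>i\<in>F. c i * v i x)) < \<epsilon>"
    if f: "f \<in> L2_space M" "\<epsilon> > 0" for f and \<epsilon> :: real
  proof -
    obtain F c where F: "finite F" "F \<subseteq> I" "L2_norm M (\<lambda>x. f x - (\<Sum>i\<in>F. c i * u i x)) < \<epsilon>"
      using L2_orthogonal_basis_dense[OF basis f] .
    have "(\<Sum>i\<in>F. c i * u i x) = (\<Sum>i\<in>F. c i / k i * v i x)" for x
      using F(2) k v by (intro sum.cong) auto
    then show ?thesis
      using F by (intro exI[of _ F] exI[of _ "\<lambda>i. c i / k i"]) simp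
  qed
  show ?thesis
    using basis k dense unfolding L2_orthogonal_basis_def by (auto simp: v_eq norm inner space)
qed

lemma L2_orthogonal_basis_scale_iff:
  assumes k: "\<And>i. i \<in> I \<Longrightarrow> k i \<noteq> 0"
  shows "L2_orthogonal_basis M I (\<lambda>i x. k i * u i x) \<longleftrightarrow> L2_orthogonal_basis M I u"
proof
  assume "L2_orthogonal_basis M I (\<lambda>i x. k i * u i x)"
  then show "L2_orthogonal_basis M I u"
    by (rule L2_orthogonal_basis_scale[where k = "\<lambda>i. inverse (k i)"]) (simp_all add: k)
qed (rule L2_orthogonal_basis_scale[OF _ k], auto)

text \<open>Injectivity makes distinct indices correspond to distinct images, so the orthogonality
  conditions match, and it turns a finite sum over an image into a sum over the indices without
  collapsing terms.\<close>

lemma L2_orthogonal_basis_image: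
  assumes h: "inj_on h I"
  shows "L2_orthogonal_basis M (h ` I) u \<longleftrightarrow> L2_orthogonal_basis M I (\<lambda>i. u (h i))"
proof -
  have "(\<exists>F c. finite F \<and> F \<subseteq> h ` I \<and> L2_norm M (\<lambda>x. f x - (\<Sum>i\<in>F. c i * u i x)) < \<epsilon>) \<longleftrightarrow>
      (\<exists>F c. finite F \<and> F \<subseteq> I \<and> L2_norm M (\<lambda>x. f x - (\<Sum>i\<in>F. c i * u (h i) x)) < \<epsilon>)"
    (is "?L \<longleftrightarrow> ?R") for f \<epsilon>
  proof
    assume ?L
    then obtain F c where F: "finite F" "F \<subseteq> h ` I"
      and less: "L2_norm M (\<lambda>x. f x - (\<Sum>i\<in>F. c i * u i x)) < \<epsilon>" by blast
    obtain G where G: "G \<subseteq> I" "finite G" "F = h ` G"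
      using finite_subset_image[OF F] by blast
    have "inj_on h G" using h G(1) by (rule inj_on_subset)
    then show ?R
      using G less by (intro exI[of _ G] exI[of _ "\<lambda>i. c (h i)"]) (simp add: sum.reindex)
  next
    assume ?R
    then obtain F c where F: "finite F" "F \<subseteq> I"
      and less: "L2_norm M (\<lambda>x. f x - (\<Sum>i\<in>F. c i * u (h i) x)) < \<epsilon>" by blast
    have inj: "inj_on h F" using h F(2) by (rule inj_on_subset)
    \<comment> \<open>The coefficient at \<open>h i\<close> has to be \<open>c i\<close>; since
      \<open>h\<close> is injective on \<open>F\<close>, its inverse there recovers
      \<open>i\<close>.\<close>
    have "(\<Sum>j\<in>h ` F. c (the_inv_into F h j) * u j x) = (\<Sum>i\<in>F. c i * u (h i) x)" for x
      using inj by (simp add: sum.reindex the_inv_into_f_f)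
    then show ?L
      using F less by (intro exI[of _ "h ` F"] exI[of _ "\<lambda>j. c (the_inv_into F h j)"]) auto
  qed
  then show ?thesis
    unfolding L2_orthogonal_basis_def using h by (auto simp: inj_on_eq_iff)
qed

text \<open>The phase splits because \<open>transpose V\<close> is the adjoint of \<open>V\<close>
  for the inner product; the translation \<open>s\<close> contributes only the factor
  \<open>exponential l s\<close>, which is constant in \<open>x\<close>.\<close>

lemma exponential_affine:
  "exponential l (V *v x + s) = exponential l s * exponential (transpose V *v l) x"
proof -
  have "l \<bullet> (V *v x) = (transpose V *v l) \<bullet> x"
    by (simp add: dot_lmul_matrix[symmetric])
  then show ?thesis
    by (simp add: exponential_def inner_add_right distrib_left exp_add mult.commute)
qed

section \<open>The affine group: group structure and measurability\<close>

lemma affine_group_inverse: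
  fixes a :: "real^'n \<Rightarrow> real^'n"
  assumes "a \<in> carrier affine_group"
  obtains b where "b \<in> carrier affine_group" "\<And>x. b (a x) = x" "\<And>x. a (b x) = x"
proof -
  obtain V :: "real^'n^'n" and s where V: "invertible V" and a: "a = (\<lambda>x. V *v x + s)"
    using assms by (auto simp: affine_group_def)
  obtain W where W: "V ** W = mat 1" "W ** V = mat 1"
    using V unfolding invertible_def by blast
  have "invertible W" using W unfolding invertible_def by blast
  \<comment> \<open>Solving \<open>y = V *v x + s\<close> for \<open>x\<close> gives
    \<open>W *v y - W *v s\<close>, written as a sum to fit the form required of group
    elements.\<close>
  then have "(\<lambda>x. W *v x + - (W *v s)) \<in> carrier affine_group"
    unfolding affine_group_def by fastforce
  then show thesis
    by (rule that) (simp_all add: a matrix_vector_right_distrib matrix_vector_mult_diff_distrib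
        matrix_vector_mul_assoc W)
qed

lemma group_affine_group: "group (affine_group :: (real^'n \<Rightarrow> real^'n) monoid)"
proof (rule groupI)
  fix a b :: "real^'n \<Rightarrow> real^'n"
  assume "a \<in> carrier affine_group" "b \<in> carrier affine_group"
  then obtain V W :: "real^'n^'n" and s t
    where "invertible V" "invertible W" "a = (\<lambda>x. V *v x + s)" "b = (\<lambda>x. W *v x + t)"
    by (auto simp: affine_group_def)
  then have "invertible (V ** W)" "a \<circ> b = (\<lambda>x. (V ** W) *v x + (V *v t + s))"
    by (auto simp: invertible_mult matrix_vector_right_distrib matrix_vector_mul_assoc)
  then show "a \<otimes>\<^bsub>affine_group\<^esub> b \<in> carrier affine_group"
    by (auto simp: affine_group_def)
next
  have "invertible (mat 1 :: real^'n^'n)" by (auto simp: invertible_def)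
  moreover have "id = (\<lambda>x. mat 1 *v x + (0 :: real^'n))" by (simp add: fun_eq_iff)
  ultimately show "\<one>\<^bsub>affine_group\<^esub> \<in> carrier (affine_group :: (real^'n \<Rightarrow> real^'n) monoid)"
    unfolding affine_group_def monoid.simps partial_object.simps mem_Collect_eq by blast
next
  fix a :: "real^'n \<Rightarrow> real^'n"
  assume "a \<in> carrier affine_group"
  then obtain b where "b \<in> carrier affine_group" "\<And>x. b (a x) = x"
    using affine_group_inverse by metis
  then show "\<exists>b\<in>carrier affine_group. b \<otimes>\<^bsub>affine_group\<^esub> a = \<one>\<^bsub>affine_group\<^esub>"
    by (auto simp: affine_group_def fun_eq_iff)
qed (auto simp: affine_group_def)

lemma borel_measurable_affine_group:
  fixes a :: "real^'n \<Rightarrow> real^'n"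
  assumes "a \<in> carrier affine_group"
  shows "a \<in> borel_measurable borel"
proof -
  obtain V :: "real^'n^'n" and s where "a = (\<lambda>x. V *v x + s)"
    using assms by (auto simp: affine_group_def)
  then have "continuous_on UNIV a"
    by (simp only:) (intro continuous_on_add continuous_on_const linear_continuous_on
        matrix_vector_mul_bounded_linear)
  then show ?thesis
    by (rule borel_measurable_continuous_onI)
qed

section \<open>The action on finite Borel measures\<close>

lemma push_forward_finite_borel_measures:
  assumes "a \<in> carrier affine_group" "\<mu> \<in> finite_borel_measures"
  shows "push_forward a \<mu> \<in> finite_borel_measures"
  using assms borel_measurable_affine_group[OF assms(1)]
  by (auto simp: finite_borel_measures_def push_forward_def
      intro!: finite_measure.finite_measure_distr cong: measurable_cong_sets)

lemma push_forward_comp: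
  assumes "a \<in> carrier affine_group" "b \<in> carrier affine_group" "\<mu> \<in> finite_borel_measures"
  shows "push_forward (a \<circ> b) \<mu> = push_forward a (push_forward b \<mu>)"
  using assms borel_measurable_affine_group[OF assms(1)] borel_measurable_affine_group[OF assms(2)]
  by (simp add: push_forward_def finite_borel_measures_def distr_distr cong: measurable_cong_sets)

lemma push_forward_id:
  assumes "\<mu> \<in> finite_borel_measures"
  shows "push_forward id \<mu> = \<mu>"
  using assms by (simp add: push_forward_def finite_borel_measures_def distr_id2 id_def)

text \<open>By functoriality, the push-forward along the inverse of \<open>a\<close> is a two-sided
  inverse of the push-forward along \<open>a\<close>.\<close>

lemma bij_betw_push_forward:
  fixes a :: "real^'n \<Rightarrow> real^'n"
  assumes a: "a \<in> carrier affine_group"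
  shows "bij_betw (push_forward a) finite_borel_measures finite_borel_measures"
proof -
  obtain b where b: "b \<in> carrier affine_group" and eq: "b \<circ> a = id" "a \<circ> b = id"
    using affine_group_inverse[OF a] by (metis comp_apply eq_id_iff)
  show ?thesis
    by (rule bij_betw_byWitness[where f' = "push_forward b"])
      (use a b eq in \<open>auto simp: push_forward_comp[symmetric] push_forward_id
        push_forward_finite_borel_measures\<close>)
qed

text \<open>An action is a homomorphism into \<open>BijGroup\<close>, whose elements are extensional
  bijections; this is why \<open>push_forward a\<close> is restricted to the finite Borel measures.
  Multiplicativity is functoriality of image measures, which respects the order of
  composition.\<close>

lemma group_action_push_forward:
  "group_action (affine_group :: (real^'n \<Rightarrow> real^'n) monoid) finite_borel_measures
     (\<lambda>a. \<lambda>\<mu>\<in>finite_borel_measures. push_forward a \<mu>)"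
proof -
  have Bij: "(\<lambda>\<mu>\<in>finite_borel_measures. push_forward a \<mu>) \<in> Bij finite_borel_measures"
    if "a \<in> carrier affine_group" for a :: "real^'n \<Rightarrow> real^'n"
    using bij_betw_push_forward[OF that] by (auto simp: Bij_def)
  have "(\<lambda>\<mu>\<in>finite_borel_measures. push_forward (a \<otimes>\<^bsub>affine_group\<^esub> b) \<mu>) =
      compose finite_borel_measures (\<lambda>\<mu>\<in>finite_borel_measures. push_forward a \<mu>)
        (\<lambda>\<mu>\<in>finite_borel_measures. push_forward b \<mu>)"
    if "a \<in> carrier affine_group" "b \<in> carrier affine_group" for a b :: "real^'n \<Rightarrow> real^'n"
  proof -
    have "a \<otimes>\<^bsub>affine_group\<^esub> b = a \<circ> b" by (simp add: affine_group_def)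
    then show ?thesis
      using that by (auto simp: compose_def push_forward_comp push_forward_finite_borel_measures)
  qed
  then show ?thesis
    unfolding group_action_def group_hom_def group_hom_axioms_def hom_def
    using Bij group_affine_group group_BijGroup[of finite_borel_measures]
    by (auto simp: BijGroup_def)
qed

section \<open>Spectra of push-forwards\<close>

lemma spectra_push_forward_iff:
  fixes V :: "real^'n^'n"
  assumes V: "invertible V" and \<mu>: "\<mu> \<in> finite_borel_measures"
  shows "\<Lambda> \<in> spectra (push_forward (\<lambda>x. V *v x + s) \<mu>) \<longleftrightarrow>
    (\<lambda>l. transpose V *v l) ` \<Lambda> \<in> spectra \<mu>"
proof -
  let ?a = "\<lambda>x. V *v x + s"
  have a: "?a \<in> carrier affine_group"
    using V by (auto simp: affine_group_def)
  obtain b where b: "b \<in> carrier affine_group" "\<And>x. b (?a x) = x" "\<And>x. ?a (b x) = x"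
    using affine_group_inverse[OF a] by blast
  \<comment> \<open>Both claims reduce to Borel measurability of affine maps, because
    \<open>\<mu>\<close> carries the Borel sigma-algebra.\<close>
  have meas: "?a \<in> measurable \<mu> borel" "b \<in> measurable borel \<mu>"
    using a b(1) \<mu>
    by (auto simp: finite_borel_measures_def cong: measurable_cong_sets
        dest: borel_measurable_affine_group)
  have "inj ((*v) (transpose V))"
    using V inj_matrix_vector_mult transpose_invertible by blast
  then have inj: "inj_on (\<lambda>l. transpose V *v l) \<Lambda>"
    by (auto simp: inj_on_def)
  have "\<Lambda> \<in> spectra (push_forward ?a \<mu>) \<longleftrightarrow>
      L2_orthogonal_basis \<mu> \<Lambda> (\<lambda>l x. exponential l (?a x))"
    unfolding spectra_def push_forward_def
    using L2_orthogonal_basis_distr_iff[OF meas b(2,3)] by simp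
  \<comment> \<open>The factor dropped here is \<open>exponential l s\<close>, which is nonzero as a
    value of the complex exponential function.\<close>
  also have "\<dots> \<longleftrightarrow> L2_orthogonal_basis \<mu> \<Lambda> (\<lambda>l. exponential (transpose V *v l))"
    unfolding exponential_affine
    by (rule L2_orthogonal_basis_scale_iff) (simp add: exponential_def)
  also have "\<dots> \<longleftrightarrow> (\<lambda>l. transpose V *v l) ` \<Lambda> \<in> spectra \<mu>"
    unfolding spectra_def mem_Collect_eq by (rule L2_orthogonal_basis_image[OF inj, symmetric])
  finally show ?thesis .
qed

text \<open>If \<open>W\<close> is a right inverse of \<open>transpose V\<close>, then
  \<open>transpose V\<close> maps the image of \<open>\<Lambda>\<close> under \<open>W\<close> back
  onto \<open>\<Lambda>\<close>. The equivalence for spectra, read from right to left, makes that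
  image a spectrum for the push-forward.\<close>

lemma push_forward_spectral_measures:
  fixes a :: "real^'n \<Rightarrow> real^'n"
  assumes a: "a \<in> carrier affine_group" and \<mu>: "\<mu> \<in> spectral_measures"
  shows "push_forward a \<mu> \<in> spectral_measures"
proof -
  obtain V :: "real^'n^'n" and s where V: "invertible V" and a_eq: "a = (\<lambda>x. V *v x + s)"
    using a by (auto simp: affine_group_def)
  obtain \<Lambda> where \<mu>': "\<mu> \<in> finite_borel_measures" and \<Lambda>: "\<Lambda> \<in> spectra \<mu>"
    using \<mu> by (auto simp: spectral_measures_def)
  obtain W where W: "transpose V ** W = mat 1"
    using transpose_invertible[OF V] unfolding invertible_def by blast
  have "(\<lambda>l. transpose V *v l) ` ((\<lambda>l. W *v l) ` \<Lambda>) = \<Lambda>"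
    unfolding image_image matrix_vector_mul_assoc W by simp
  then have "(\<lambda>l. W *v l) ` \<Lambda> \<in> spectra (push_forward a \<mu>)"
    using \<Lambda> spectra_push_forward_iff[OF V \<mu>'] by (simp add: a_eq)
  then show ?thesis
    using push_forward_finite_borel_measures[OF a \<mu>'] by (auto simp: spectral_measures_def)
qed

text \<open>Membership in the group only provides some representation with an invertible matrix,
  whereas the theorem speaks of an arbitrary one. The two agree: the value at 0 determines the
  translation, and then the matrix is determined.\<close>

lemma affine_group_linear_part_invertible:
  fixes V :: "real^'n^'n"
  assumes "(\<lambda>x. V *v x + s) \<in> carrier affine_group"
  shows "invertible V"
proof -
  obtain V' :: "real^'n^'n" and s' where V': "invertible V'"
    and eq: "\<And>x. V *v x + s = V' *v x + s'"
    using assms by (auto simp: affine_group_def fun_eq_iff)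
  have "s = s'" using eq[of 0] by simp
  then have "V = V'" using eq by (simp add: matrix_eq)
  then show ?thesis using V' by simp
qed

theorem corollary3p4:
  shows "group_action (affine_group :: (real^'n \<Rightarrow> real^'n) monoid) finite_borel_measures
           (\<lambda>a. \<lambda>\<mu>\<in>finite_borel_measures. push_forward a \<mu>)
    \<and> (\<forall>a \<in> carrier (affine_group :: (real^'n \<Rightarrow> real^'n) monoid).
          \<forall>\<mu> \<in> spectral_measures. push_forward a \<mu> \<in> spectral_measures)
    \<and> (\<forall>a \<in> carrier (affine_group :: (real^'n \<Rightarrow> real^'n) monoid).
          \<forall>(V :: real^'n^'n) s. (\<forall>x. a x = V *v x + s) \<longrightarrow>
            (\<forall>\<mu> \<in> finite_borel_measures. \<forall>\<Lambda>.
               \<Lambda> \<in> spectra (push_forward a \<mu>) \<longleftrightarrow>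
               (\<lambda>l. transpose V *v l) ` \<Lambda> \<in> spectra \<mu>))"
proof (intro conjI ballI allI impI)
  fix a :: "real^'n \<Rightarrow> real^'n" and V :: "real^'n^'n" and s
    and \<mu> :: "(real^'n) measure" and \<Lambda> :: "(real^'n) set"
  assume a: "a \<in> carrier affine_group" "\<forall>x. a x = V *v x + s" and \<mu>: "\<mu> \<in> finite_borel_measures"
  have a_eq: "a = (\<lambda>x. V *v x + s)" using a(2) by auto
  have "invertible V"
    using a(1) unfolding a_eq by (rule affine_group_linear_part_invertible)
  then show "\<Lambda> \<in> spectra (push_forward a \<mu>) \<longleftrightarrow> (\<lambda>l. transpose V *v l) ` \<Lambda> \<in> spectra \<mu>"
    unfolding a_eq by (rule spectra_push_forward_iff[OF _ \<mu>])
qed (simp_all only: group_action_push_forward push_forward_spectral_measures)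

end
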